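(* Let $(A,\{\cdot,\cdot\},\mu,\alpha,\beta)$ be a BiHom-Poisson algebra and let $(V,\phi,\psi)$ be a left BiHom-Poisson $A$-module with structure maps $\lambda$ and $\rho$, with $\alpha$ and $\psi$ invertible so that the formulas below make sense. Then $(A\oplus V,[\cdot,\cdot],\ast,\tilde\alpha,\tilde\beta)$ is a BiHom-Poisson algebra (with bracket $[\cdot,\cdot]$ and BiHom-associative product $\ast$), called the semidirect product of $(A,\{\cdot,\cdot\},\mu,\alpha,\beta)$ and $(V,\phi,\psi)$, where for $a,b\in A$, $u,v\in V$: $$(a+u)\ast(b+v)=\mu(a,b)+\lambda(a,v)+\lambda(\alpha^{-1}\beta(b),\psi^{-1}\phi(u)),$$ $$[a+u,b+v]=\{a,b\}+\rho(a,v)-\rho(\alpha^{-1}\beta(b),\psi^{-1}\phi(u)),$$ $$\tilde\alpha(a+u)=\alpha(a)+\phi(u),\qquad\tilde\beta(a+u)=\beta(a)+\psi(u).$$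
   Context: All vector spaces are over an algebraically closed field $\mathbb{K}$ of characteristic $0$. A BiHom-Poisson algebra is a tuple $(A,\{\cdot,\cdot\},\mu,\alpha,\beta)$ with $A$ a vector space, $\mu,\{\cdot,\cdot\}:A\times A\to A$ bilinear and $\alpha,\beta:A\to A$ linear with $\alpha\beta=\beta\alpha$, such that for all $x,y,z\in A$: (i) $\alpha$ and $\beta$ are multiplicative for both products, i.e. $\gamma(\mu(x,y))=\mu(\gamma(x),\gamma(y))$ and $\gamma(\{x,y\})=\{\gamma(x),\gamma(y)\}$ for $\gamma\in\{\alpha,\beta\}$; (ii) BiHom-commutativity: $\mu(\beta(x),\alpha(y))=\mu(\beta(y),\alpha(x))$; (iii) BiHom-associativity: $\mu(\mu(x,y),\beta(z))=\mu(\alpha(x),\mu(y,z))$; (iv) BiHom-skew-symmetry: $\{\beta(x),\alpha(y)\}=-\{\beta(y),\alpha(x)\}$; (v) BiHom-Jacobi identity: $\{\beta^2(x),\{\beta(y),\alpha(z)\}\}+\{\beta^2(y),\{\beta(z),\alpha(x)\}\}+\{\beta^2(z),\{\beta(x),\alpha(y)\}\}=0$; (vi) BiHom-Leibniz identity: $\{\alpha\beta(x),\mu(y,z)\}=\mu(\{\beta(x),y\},\beta(z))+\mu(\beta(y),\{\alpha(x),z\})$. A BiHom-module is $(V,\phi,\psi)$ with $V$ a vector space and $\phi,\psi:V\to V$ commuting linear maps. A left BiHom-Poisson $A$-module is a BiHom-module $(V,\phi,\psi)$ with structure maps, i.e. bilinear maps $\lambda,\rho:A\times V\to V$ that are morphisms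 of BiHom-modules ($\phi(\lambda(x,v))=\lambda(\alpha(x),\phi(v))$, $\psi(\lambda(x,v))=\lambda(\beta(x),\psi(v))$, and likewise for $\rho$), such that for all $x,y\in A$, $v\in V$: $\lambda(\alpha(x),\lambda(y,v))=\lambda(\mu(x,y),\psi(v))$; $\rho(\{\beta(x),y\},\psi(v))=\rho(\alpha\beta(x),\rho(y,v))-\rho(\beta(y),\rho(\alpha(x),v))$; $\rho(\alpha\beta(x),\lambda(y,v))=\lambda(\{\beta(x),y\},\psi(v))+\lambda(\beta(y),\rho(\alpha(x),v))$; $\rho(\mu(\beta(x),y),\psi(v))=\lambda(\alpha\beta(x),\rho(y,v))+\lambda(\beta(y),\rho(\alpha(x),v))$. *)

theory Defs
  imports
    "HOL-Computational_Algebra.Polynomial"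
    "HOL-Analysis.Product_Vector"
begin

text \<open>
  Vector spaces are whole types carrying a scalar multiplication, over a field type of sort
  \<^class>\<open>alg_closed_field\<close> and \<^class>\<open>field_char_0\<close>.
\<close>

definition bilinear_map ::
  "('k::field \<Rightarrow> 'a::ab_group_add \<Rightarrow> 'a) \<Rightarrow> ('k \<Rightarrow> 'b::ab_group_add \<Rightarrow> 'b) \<Rightarrow>
   ('k \<Rightarrow> 'c::ab_group_add \<Rightarrow> 'c) \<Rightarrow> ('a \<Rightarrow> 'b \<Rightarrow> 'c) \<Rightarrow> bool"
  where "bilinear_map s1 s2 s3 f \<longleftrightarrow>
    (\<forall>x. Vector_Spaces.linear s2 s3 (\<lambda>y. f x y)) \<and>
    (\<forall>y. Vector_Spaces.linear s1 s3 (\<lambda>x. f x y))"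

locale bihom_module = vector_space scale
  for scale :: "'k::{alg_closed_field,field_char_0} \<Rightarrow> 'v::ab_group_add \<Rightarrow> 'v" +
  fixes \<phi> \<psi> :: "'v \<Rightarrow> 'v"
  assumes linear_phi: "Vector_Spaces.linear scale scale \<phi>"
    and linear_psi: "Vector_Spaces.linear scale scale \<psi>"
    and commute: "\<phi> \<circ> \<psi> = \<psi> \<circ> \<phi>"

locale bihom_poisson_algebra = vector_space scale
  for scale :: "'k::{alg_closed_field,field_char_0} \<Rightarrow> 'a::ab_group_add \<Rightarrow> 'a" +
  fixes br \<mu> :: "'a \<Rightarrow> 'a \<Rightarrow> 'a"
    and \<alpha> \<beta> :: "'a \<Rightarrow> 'a"
  assumes bilinear_mu: "bilinear_map scale scale scale \<mu>"
    and bilinear_br: "bilinear_map scale scale scale br"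
    and linear_alpha: "Vector_Spaces.linear scale scale \<alpha>"
    and linear_beta: "Vector_Spaces.linear scale scale \<beta>"
    and alpha_beta: "\<alpha> \<circ> \<beta> = \<beta> \<circ> \<alpha>"
    and alpha_mu: "\<alpha> (\<mu> x y) = \<mu> (\<alpha> x) (\<alpha> y)"
    and beta_mu: "\<beta> (\<mu> x y) = \<mu> (\<beta> x) (\<beta> y)"
    and alpha_br: "\<alpha> (br x y) = br (\<alpha> x) (\<alpha> y)"
    and beta_br: "\<beta> (br x y) = br (\<beta> x) (\<beta> y)"
    and bihom_commutative: "\<mu> (\<beta> x) (\<alpha> y) = \<mu> (\<beta> y) (\<alpha> x)"
    and bihom_associative: "\<mu> (\<mu> x y) (\<beta> z) = \<mu> (\<alpha> x) (\<mu> y z)"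
    and bihom_skew: "br (\<beta> x) (\<alpha> y) = - br (\<beta> y) (\<alpha> x)"
    and bihom_jacobi:
      "br (\<beta> (\<beta> x)) (br (\<beta> y) (\<alpha> z)) + br (\<beta> (\<beta> y)) (br (\<beta> z) (\<alpha> x))
        + br (\<beta> (\<beta> z)) (br (\<beta> x) (\<alpha> y)) = 0"
    and bihom_leibniz:
      "br (\<alpha> (\<beta> x)) (\<mu> y z) = \<mu> (br (\<beta> x) y) (\<beta> z) + \<mu> (\<beta> y) (br (\<alpha> x) z)"

locale left_bihom_poisson_module =
  A: bihom_poisson_algebra sA br \<mu> \<alpha> \<beta> + V: bihom_module sV \<phi> \<psi>
  for sA :: "'k::{alg_closed_field,field_char_0} \<Rightarrow> 'a::ab_group_add \<Rightarrow> 'a"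
    and br \<mu> :: "'a \<Rightarrow> 'a \<Rightarrow> 'a"
    and \<alpha> \<beta> :: "'a \<Rightarrow> 'a"
    and sV :: "'k \<Rightarrow> 'v::ab_group_add \<Rightarrow> 'v"
    and \<phi> \<psi> :: "'v \<Rightarrow> 'v" +
  fixes lam \<rho> :: "'a \<Rightarrow> 'v \<Rightarrow> 'v"
  assumes bilinear_lam: "bilinear_map sA sV sV lam"
    and bilinear_rho: "bilinear_map sA sV sV \<rho>"
    and phi_lam: "\<phi> (lam x v) = lam (\<alpha> x) (\<phi> v)"
    and psi_lam: "\<psi> (lam x v) = lam (\<beta> x) (\<psi> v)"
    and phi_rho: "\<phi> (\<rho> x v) = \<rho> (\<alpha> x) (\<phi> v)"
    and psi_rho: "\<psi> (\<rho> x v) = \<rho> (\<beta> x) (\<psi> v)"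
    and lam_lam: "lam (\<alpha> x) (lam y v) = lam (\<mu> x y) (\<psi> v)"
    and rho_br:
      "\<rho> (br (\<beta> x) y) (\<psi> v) = \<rho> (\<alpha> (\<beta> x)) (\<rho> y v) - \<rho> (\<beta> y) (\<rho> (\<alpha> x) v)"
    and rho_lam:
      "\<rho> (\<alpha> (\<beta> x)) (lam y v) = lam (br (\<beta> x) y) (\<psi> v) + lam (\<beta> y) (\<rho> (\<alpha> x) v)"
    and rho_mu:
      "\<rho> (\<mu> (\<beta> x) y) (\<psi> v) = lam (\<alpha> (\<beta> x)) (\<rho> y v) + lam (\<beta> y) (\<rho> (\<alpha> x) v)"

text \<open>
  The direct sum of \<open>A\<close> and \<open>V\<close> is the product type, the pair \<open>(a, u)\<close> standing for \<open>a + u\<close>.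
  As \<open>inv\<close> is a choice of inverse, the next two definitions are meaningful only for
  bijective \<open>\<alpha>\<close> and \<open>\<psi>\<close>.
\<close>

definition semidirect_mult ::
  "('a \<Rightarrow> 'a \<Rightarrow> 'a) \<Rightarrow> ('a \<Rightarrow> 'a) \<Rightarrow> ('a \<Rightarrow> 'a) \<Rightarrow> ('v \<Rightarrow> 'v) \<Rightarrow> ('v \<Rightarrow> 'v) \<Rightarrow>
   ('a \<Rightarrow> 'v \<Rightarrow> 'v::ab_group_add) \<Rightarrow> 'a \<times> 'v \<Rightarrow> 'a \<times> 'v \<Rightarrow> 'a \<times> 'v"
  where "semidirect_mult \<mu> \<alpha> \<beta> \<phi> \<psi> lam = (\<lambda>(a, u) (b, v).
    (\<mu> a b, lam a v + lam (inv \<alpha> (\<beta> b)) (inv \<psi> (\<phi> u))))"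

definition semidirect_bracket ::
  "('a \<Rightarrow> 'a \<Rightarrow> 'a) \<Rightarrow> ('a \<Rightarrow> 'a) \<Rightarrow> ('a \<Rightarrow> 'a) \<Rightarrow> ('v \<Rightarrow> 'v) \<Rightarrow> ('v \<Rightarrow> 'v) \<Rightarrow>
   ('a \<Rightarrow> 'v \<Rightarrow> 'v::ab_group_add) \<Rightarrow> 'a \<times> 'v \<Rightarrow> 'a \<times> 'v \<Rightarrow> 'a \<times> 'v"
  where "semidirect_bracket br \<alpha> \<beta> \<phi> \<psi> \<rho> = (\<lambda>(a, u) (b, v).
    (br a b, \<rho> a v - \<rho> (inv \<alpha> (\<beta> b)) (inv \<psi> (\<phi> u))))"

end

theory Submission
  imports Defs
begin

text \<open>
  Write \<open>\<iota> = \<alpha>\<inverse>\<beta>\<close> and \<open>\<kappa> = \<psi>\<inverse>\<phi>\<close>. The products on \<open>A \<oplus> V\<close> are the ones of \<open>A\<close>, extended by zero on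
  \<open>V \<times> V\<close>, by the left action on \<open>A \<times> V\<close>, and by the right action \<open>u \<cdot> b = \<plusminus> (\<iota> b) \<cdot> (\<kappa> u)\<close> on
  \<open>V \<times> A\<close>. BiHom-(skew-)commutativity leaves no other choice: it demands
  \<open>\<psi> v \<cdot> \<alpha> b = \<plusminus> (\<beta> b) \<cdot> (\<phi> v)\<close>, and \<open>\<alpha>\<close> and \<open>\<psi>\<close> are onto.

  All axioms are additive in every argument, and both sides vanish as soon as two arguments lie in
  \<open>V\<close>. Hence each axiom splits into its instance for \<open>A\<close> and one identity in \<open>V\<close> for every
  position of the single argument from \<open>V\<close>. The identities for BiHom-(skew-)commutativity hold by
  the choice of the right action, and those for the structure maps \<open>\<alpha> \<oplus> \<phi>\<close> and \<open>\<beta> \<oplus> \<psi>\<close> because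
  the actions are morphisms. For associativity and the Leibniz identity, the last position gives a
  module axiom; the other positions, and the Jacobi identity, whose three positions agree by cyclic
  symmetry, give a module axiom read through the twists.

  There are two tools for this reading. First, \<open>\<iota>\<close> commutes with \<open>\<alpha>\<close> and \<open>\<beta>\<close> and respects both
  products of \<open>A\<close>. Second, \<open>\<kappa>\<close> moves past an action by the exchange rule
  \<open>\<kappa> (\<beta> x \<cdot> v) = \<alpha> x \<cdot> \<kappa> v\<close> (lemmas \<open>kappa_lam\<close> and \<open>kappa_rho\<close>). The rule needs an argument in
  the image of \<open>\<beta>\<close>, which need not be everything. In associativity with the middle argument in \<open>V\<close>
  (lemma \<open>lam_lam_middle\<close>) \<open>\<kappa>\<close> meets the action of an arbitrary element; there the injective map
  \<open>\<psi>\<close> is applied to both sides and brings in the missing \<open>\<beta>\<close>.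
\<close>

section \<open>Bilinear maps\<close>

lemma bilinear_map_add_right:
  "bilinear_map s1 s2 s3 f \<Longrightarrow> f x (u + v) = f x u + f x v"
  by (simp add: bilinear_map_def Vector_Spaces.linear_iff)

lemma bilinear_map_diff_right:
  assumes "bilinear_map s1 s2 s3 f"
  shows "f x (u - v) = f x u - f x v"
  using bilinear_map_add_right[OF assms, of x "u - v" v] by (simp add: eq_diff_eq)

lemma bilinear_map_uminus:
  assumes "bilinear_map s1 s2 s3 f"
  shows "bilinear_map s1 s2 s3 (\<lambda>x y. - f x y)"
proof -
  have "vector_space s3"
    using assms by (simp add: bilinear_map_def Vector_Spaces.linear_iff)
  then interpret vector_space s3 .
  show ?thesis
    using assms by (simp add: bilinear_map_def Vector_Spaces.linear_iff)
qed

lemma bilinear_map_twisted_flip: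
  assumes "bilinear_map s1 s2 s3 f"
    and "Vector_Spaces.linear t1 s1 g" and "Vector_Spaces.linear t2 s2 h"
  shows "bilinear_map t2 t1 s3 (\<lambda>u b. f (g b) (h u))"
  using assms by (simp add: bilinear_map_def Vector_Spaces.linear_iff)

lemma linear_inv:
  assumes "Vector_Spaces.linear s1 s2 f" and "bij f"
  shows "Vector_Spaces.linear s2 s1 (inv f)"
proof -
  have "inv f (x + y) = inv f x + inv f y" for x y
    using assms by (intro inv_f_eq)
      (auto simp: Vector_Spaces.linear_iff bij_is_inj bij_is_surj surj_f_inv_f)
  moreover have "inv f (s2 c x) = s1 c (inv f x)" for c x
    using assms by (intro inv_f_eq)
      (auto simp: Vector_Spaces.linear_iff bij_is_inj bij_is_surj surj_f_inv_f)
  ultimately show ?thesis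
    using assms(1) by (simp add: Vector_Spaces.linear_iff)
qed

lemma vector_space_prod_scale:
  assumes "vector_space s1" and "vector_space s2"
  shows "vector_space (module_prod.scale s1 s2)"
    and "module_prod.scale s1 s2 c (x, y) = (s1 c x, s2 c y)"
proof -
  interpret vector_space_prod s1 s2
    using assms by (simp add: vector_space_prod_def vector_space_pair_def)
  show "vector_space (module_prod.scale s1 s2)" ..
  show "module_prod.scale s1 s2 c (x, y) = (s1 c x, s2 c y)"
    by (rule scale_prod)
qed

lemma linear_map_prod:
  assumes "Vector_Spaces.linear s1 s1 f" and "Vector_Spaces.linear s2 s2 g"
  shows "Vector_Spaces.linear (module_prod.scale s1 s2) (module_prod.scale s1 s2) (map_prod f g)"
  using assms by (auto simp: Vector_Spaces.linear_iff vector_space_prod_scale)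

lemma bilinear_map_split_extension:
  assumes m: "bilinear_map s1 s1 s1 m"
    and l: "bilinear_map s1 s2 s2 l"
    and r: "bilinear_map s2 s1 s2 r"
  shows "bilinear_map (module_prod.scale s1 s2) (module_prod.scale s1 s2) (module_prod.scale s1 s2)
    (\<lambda>(a, u) (b, v). (m a b, l a v + r u b))"
proof -
  have "vector_space s1" "vector_space s2"
    using l by (simp_all add: bilinear_map_def Vector_Spaces.linear_iff)
  then interpret vector_space_prod s1 s2
    by (simp add: vector_space_prod_def vector_space_pair_def)
  show ?thesis
    using m l r p.vector_space_axioms
    by (auto simp: bilinear_map_def Vector_Spaces.linear_iff scale_prod
        vs2.scale_right_distrib add_ac)
qed

section \<open>The twists of an invertible module\<close>

locale invertible_left_bihom_poisson_module =
  left_bihom_poisson_module sA br \<mu> \<alpha> \<beta> sV \<phi> \<psi> lam \<rho>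
  for sA :: "'k::{alg_closed_field,field_char_0} \<Rightarrow> 'a::ab_group_add \<Rightarrow> 'a"
    and br \<mu> :: "'a \<Rightarrow> 'a \<Rightarrow> 'a"
    and \<alpha> \<beta> :: "'a \<Rightarrow> 'a"
    and sV :: "'k \<Rightarrow> 'v::ab_group_add \<Rightarrow> 'v"
    and \<phi> \<psi> :: "'v \<Rightarrow> 'v"
    and lam \<rho> :: "'a \<Rightarrow> 'v \<Rightarrow> 'v" +
  assumes bij_alpha: "bij \<alpha>"
    and bij_psi: "bij \<psi>"
begin

definition \<iota> :: "'a \<Rightarrow> 'a" where "\<iota> x = inv \<alpha> (\<beta> x)"

definition \<kappa> :: "'v \<Rightarrow> 'v" where "\<kappa> v = inv \<psi> (\<phi> v)"

lemma alpha_inject: "\<alpha> x = \<alpha> y \<longleftrightarrow> x = y"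
  using bij_alpha by (simp add: bij_is_inj inj_eq)

lemma psi_inject: "\<psi> u = \<psi> v \<longleftrightarrow> u = v"
  using bij_psi by (simp add: bij_is_inj inj_eq)

lemma alpha_beta_apply: "\<alpha> (\<beta> x) = \<beta> (\<alpha> x)"
  using A.alpha_beta by (metis comp_apply)

lemma psi_phi_apply: "\<psi> (\<phi> v) = \<phi> (\<psi> v)"
  using V.commute by (metis comp_apply)

lemma alpha_iota: "\<alpha> (\<iota> x) = \<beta> x"
  using bij_alpha by (simp add: \<iota>_def bij_is_surj surj_f_inv_f)

lemma psi_kappa: "\<psi> (\<kappa> v) = \<phi> v"
  using bij_psi by (simp add: \<kappa>_def bij_is_surj surj_f_inv_f)

lemma iota_alpha: "\<iota> (\<alpha> x) = \<beta> x"
  by (subst alpha_inject[symmetric]) (simp add: alpha_iota alpha_beta_apply)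

lemma iota_beta: "\<iota> (\<beta> x) = \<beta> (\<iota> x)"
  by (subst alpha_inject[symmetric]) (simp add: alpha_iota alpha_beta_apply)

lemma kappa_psi: "\<kappa> (\<psi> v) = \<phi> v"
  by (subst psi_inject[symmetric]) (simp add: psi_kappa psi_phi_apply)

lemma kappa_phi: "\<kappa> (\<phi> v) = \<phi> (\<kappa> v)"
  by (subst psi_inject[symmetric]) (simp add: psi_kappa psi_phi_apply)

lemma iota_mu: "\<iota> (\<mu> x y) = \<mu> (\<iota> x) (\<iota> y)"
  by (subst alpha_inject[symmetric]) (simp add: alpha_iota A.alpha_mu A.beta_mu)

lemma iota_br: "\<iota> (br x y) = br (\<iota> x) (\<iota> y)"
  by (subst alpha_inject[symmetric]) (simp add: alpha_iota A.alpha_br A.beta_br)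

lemma linear_iota: "Vector_Spaces.linear sA sA \<iota>"
  using linear_inv[OF A.linear_alpha bij_alpha] A.linear_beta
  by (simp add: Vector_Spaces.linear_iff \<iota>_def)

lemma linear_kappa: "Vector_Spaces.linear sV sV \<kappa>"
  using linear_inv[OF V.linear_psi bij_psi] V.linear_phi
  by (simp add: Vector_Spaces.linear_iff \<kappa>_def)

lemma kappa_add: "\<kappa> (u + v) = \<kappa> u + \<kappa> v"
  using linear_kappa by (simp add: Vector_Spaces.linear_iff)

lemma kappa_diff: "\<kappa> (u - v) = \<kappa> u - \<kappa> v"
  using kappa_add[of "u - v" v] by (simp add: eq_diff_eq)

lemmas twist_simps =
  alpha_beta_apply psi_phi_apply alpha_iota psi_kappa iota_alpha iota_beta kappa_psi kappa_phi
  iota_mu iota_br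

lemma kappa_lam: "\<kappa> (lam (\<beta> x) v) = lam (\<alpha> x) (\<kappa> v)"
  by (subst psi_inject[symmetric]) (simp add: twist_simps phi_lam psi_lam)

lemma kappa_rho: "\<kappa> (\<rho> (\<beta> x) v) = \<rho> (\<alpha> x) (\<kappa> v)"
  by (subst psi_inject[symmetric]) (simp add: twist_simps phi_rho psi_rho)

text \<open>
  A value of \<open>\<iota>\<close> is \<open>\<beta>\<close> of an \<open>\<alpha>\<close>-preimage, so the exchange rule applies to it and removes the
  twist.
\<close>

lemma kappa_lam_iota: "\<kappa> (lam (\<iota> x) v) = lam x (\<kappa> v)"
proof -
  obtain y where "x = \<alpha> y"
    using bij_alpha by (metis bij_pointE)
  then show ?thesis
    by (simp add: iota_alpha kappa_lam)
qed

section \<open>The module axioms with the element of V in another position\<close>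

text \<open>
  BiHom-commutativity, stated for an arbitrary second factor so that it applies to the products
  that \<open>lam_lam\<close> produces.
\<close>

lemma mu_iota: "\<mu> (\<beta> x) y = \<mu> (\<iota> y) (\<alpha> x)"
proof -
  obtain z where "y = \<alpha> z"
    using bij_alpha by (metis bij_pointE)
  then show ?thesis
    by (simp add: iota_alpha A.bihom_commutative)
qed

text \<open>
  Two right multiplications of an element of \<open>V\<close> become left actions in the opposite order;
  BiHom-commutativity of \<open>A\<close> restores the order. The left-hand side is the one that remains after
  the exchange rule.
\<close>

lemma lam_lam_first: "lam (\<iota> (\<beta> c)) (lam b (\<kappa> u)) = lam (\<mu> (\<iota> b) (\<iota> c)) (\<phi> u)"
proof -
  have "lam (\<iota> (\<beta> c)) (lam b (\<kappa> u)) = lam (\<alpha> (\<iota> (\<iota> c))) (lam b (\<kappa> u))"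
    by (simp add: twist_simps)
  also have "\<dots> = lam (\<mu> (\<iota> (\<iota> c)) b) (\<phi> u)"
    by (simp add: lam_lam psi_kappa)
  also have "\<mu> (\<iota> (\<iota> c)) b = \<mu> (\<iota> b) (\<iota> c)"
  proof -
    obtain b' where "b = \<alpha> b'"
      using bij_alpha by (metis bij_pointE)
    then show ?thesis
      using mu_iota[of b' "\<iota> c"] by (simp add: iota_alpha)
  qed
  finally show ?thesis .
qed

text \<open>
  Here \<open>\<kappa>\<close> meets the action of an arbitrary \<open>a\<close>. After applying \<open>\<psi>\<close>, both sides are the action
  on \<open>\<phi> (\<psi> v)\<close> of one and the same product, up to BiHom-commutativity.
\<close>

lemma lam_lam_middle: "lam (\<iota> (\<beta> c)) (\<kappa> (lam a v)) = lam (\<alpha> a) (lam (\<iota> c) (\<kappa> v))"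
proof -
  have "\<psi> (lam (\<iota> (\<beta> c)) (\<kappa> (lam a v))) = lam (\<alpha> (\<iota> (\<iota> (\<beta> c)))) (lam (\<alpha> a) (\<phi> v))"
    by (simp add: psi_lam phi_lam twist_simps)
  also have "\<dots> = lam (\<mu> (\<iota> (\<beta> (\<iota> c))) (\<alpha> a)) (\<psi> (\<phi> v))"
    by (simp add: lam_lam iota_beta)
  also have "\<dots> = lam (\<mu> (\<beta> a) (\<beta> (\<iota> c))) (\<psi> (\<phi> v))"
    by (simp add: mu_iota)
  also have "\<dots> = \<psi> (lam (\<mu> a (\<iota> c)) (\<psi> (\<kappa> v)))"
    by (simp add: psi_lam A.beta_mu psi_kappa)
  also have "\<dots> = \<psi> (lam (\<alpha> a) (lam (\<iota> c) (\<kappa> v)))"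
    by (simp add: lam_lam)
  finally show ?thesis
    by (simp add: psi_inject)
qed

text \<open>
  In the Jacobi identity, the bracket of two elements of \<open>A\<close> acts from the right on an element of
  \<open>V\<close>.
\<close>

lemma rho_br_first:
  "\<rho> (\<iota> (br (\<beta> b) (\<alpha> c))) (\<phi> (\<psi> u)) =
    \<rho> (\<beta> (\<beta> b)) (\<rho> (\<beta> c) (\<phi> u)) - \<rho> (\<beta> (\<beta> c)) (\<rho> (\<beta> b) (\<phi> u))"
  using rho_br[of "\<iota> b" "\<beta> c" "\<phi> u"] by (simp add: twist_simps)

text \<open>
  In the Leibniz identity, an element of \<open>V\<close> as the first factor of the product leads to the module
  axiom \<open>rho_lam\<close>, exactly as one in the second factor does: the right action interchanges the two
  factors, hence also the two summands of the derivation rule. An element of \<open>V\<close> as the first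
  argument of the bracket leads to \<open>rho_mu\<close>.
\<close>

lemma rho_lam_middle:
  "\<rho> (\<alpha> (\<beta> a)) (lam (\<iota> c) (\<kappa> v)) =
    lam (\<iota> (br (\<alpha> a) c)) (\<kappa> (\<psi> v)) + lam (\<iota> (\<beta> c)) (\<kappa> (\<rho> (\<beta> a) v))"
  using rho_lam[of a "\<iota> c" "\<kappa> v"] by (simp add: twist_simps kappa_rho)

lemma rho_mu_first:
  "\<rho> (\<iota> (\<mu> b c)) (\<kappa> (\<phi> (\<psi> u))) =
    lam (\<iota> (\<beta> c)) (\<kappa> (\<rho> (\<iota> b) (\<kappa> (\<psi> u)))) + lam (\<beta> b) (\<rho> (\<iota> c) (\<kappa> (\<phi> u)))"
proof -
  \<comment> \<open>The module axiom for \<open>\<mu> (\<beta> x) y\<close> asks for an argument of the form \<open>\<beta> x\<close>; \<open>\<iota> b\<close> is one.\<close>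
  obtain b' where "b = \<alpha> b'"
    using bij_alpha by (metis bij_pointE)
  then show ?thesis
    using rho_mu[of b' "\<iota> c" "\<kappa> (\<phi> u)"] by (simp add: twist_simps kappa_rho add.commute)
qed

section \<open>The semidirect product\<close>

lemma semidirect_mult_apply:
  "semidirect_mult \<mu> \<alpha> \<beta> \<phi> \<psi> lam (a, u) (b, v) = (\<mu> a b, lam a v + lam (\<iota> b) (\<kappa> u))"
  by (simp add: semidirect_mult_def \<iota>_def \<kappa>_def)

lemma semidirect_bracket_apply:
  "semidirect_bracket br \<alpha> \<beta> \<phi> \<psi> \<rho> (a, u) (b, v) = (br a b, \<rho> a v - \<rho> (\<iota> b) (\<kappa> u))"
  by (simp add: semidirect_bracket_def \<iota>_def \<kappa>_def)

lemma bilinear_semidirect_mult: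
  "bilinear_map (module_prod.scale sA sV) (module_prod.scale sA sV) (module_prod.scale sA sV)
    (semidirect_mult \<mu> \<alpha> \<beta> \<phi> \<psi> lam)"
  using bilinear_map_split_extension[OF A.bilinear_mu bilinear_lam
      bilinear_map_twisted_flip[OF bilinear_lam linear_iota linear_kappa]]
  by (simp add: semidirect_mult_def \<iota>_def \<kappa>_def)

lemma bilinear_semidirect_bracket:
  "bilinear_map (module_prod.scale sA sV) (module_prod.scale sA sV) (module_prod.scale sA sV)
    (semidirect_bracket br \<alpha> \<beta> \<phi> \<psi> \<rho>)"
  using bilinear_map_split_extension[OF A.bilinear_br bilinear_rho
      bilinear_map_uminus[OF bilinear_map_twisted_flip[OF bilinear_rho linear_iota linear_kappa]]]
  by (simp add: semidirect_bracket_def \<iota>_def \<kappa>_def)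

lemma phi_add: "\<phi> (u + v) = \<phi> u + \<phi> v" and psi_add: "\<psi> (u + v) = \<psi> u + \<psi> v"
  using V.linear_phi V.linear_psi by (simp_all add: Vector_Spaces.linear_iff)

lemma phi_diff: "\<phi> (u - v) = \<phi> u - \<phi> v" and psi_diff: "\<psi> (u - v) = \<psi> u - \<psi> v"
  using phi_add[of "u - v" v] psi_add[of "u - v" v] by (simp_all add: eq_diff_eq)

lemmas action_additive =
  bilinear_map_add_right[OF bilinear_lam] bilinear_map_diff_right[OF bilinear_lam]
  bilinear_map_add_right[OF bilinear_rho] bilinear_map_diff_right[OF bilinear_rho]
  kappa_add kappa_diff

theorem bihom_poisson_algebra_semidirect:
  "bihom_poisson_algebra (module_prod.scale sA sV)
    (semidirect_bracket br \<alpha> \<beta> \<phi> \<psi> \<rho>)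
    (semidirect_mult \<mu> \<alpha> \<beta> \<phi> \<psi> lam)
    (map_prod \<alpha> \<phi>) (map_prod \<beta> \<psi>)"
    (is "bihom_poisson_algebra ?s ?br ?mu ?al ?be")
proof -
  have "vector_space ?s"
    by (intro vector_space_prod_scale(1) A.vector_space_axioms V.vector_space_axioms)
  then show ?thesis
  proof (rule bihom_poisson_algebra.intro[OF _ bihom_poisson_algebra_axioms.intro])
    show "bilinear_map ?s ?s ?s ?mu" "bilinear_map ?s ?s ?s ?br"
      by (fact bilinear_semidirect_mult bilinear_semidirect_bracket)+
    show "Vector_Spaces.linear ?s ?s ?al" "Vector_Spaces.linear ?s ?s ?be"
      by (intro linear_map_prod A.linear_alpha A.linear_beta V.linear_phi V.linear_psi)+
    show "?al \<circ> ?be = ?be \<circ> ?al"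
      by (auto simp: fun_eq_iff alpha_beta_apply psi_phi_apply)
  next
    fix X Y Z :: "'a \<times> 'v"
    obtain a u b v c w where XYZ [simp]: "X = (a, u)" "Y = (b, v)" "Z = (c, w)"
      by (metis surj_pair)
    note apply_simps = semidirect_mult_apply semidirect_bracket_apply
    show "?al (?mu X Y) = ?mu (?al X) (?al Y)"
      by (simp add: apply_simps A.alpha_mu phi_add phi_lam twist_simps)
    show "?be (?mu X Y) = ?mu (?be X) (?be Y)"
      by (simp add: apply_simps A.beta_mu psi_add psi_lam twist_simps)
    show "?al (?br X Y) = ?br (?al X) (?al Y)"
      by (simp add: apply_simps A.alpha_br phi_diff phi_rho twist_simps)
    show "?be (?br X Y) = ?br (?be X) (?be Y)"
      by (simp add: apply_simps A.beta_br psi_diff psi_rho twist_simps)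
    show "?mu (?be X) (?al Y) = ?mu (?be Y) (?al X)"
      by (simp add: apply_simps A.bihom_commutative[of a b] twist_simps add.commute)
    show "?br (?be X) (?al Y) = - ?br (?be Y) (?al X)"
      by (simp add: apply_simps A.bihom_skew[of a b] twist_simps)
    show "?mu (?mu X Y) (?be Z) = ?mu (?al X) (?mu Y Z)"
      using lam_lam_first[of c b "\<kappa> u"] lam_lam_middle[of c a v]
      by (simp add: apply_simps A.bihom_associative lam_lam[symmetric] action_additive
          kappa_lam_iota iota_mu kappa_phi add_ac)
    show "?br (?be (?be X)) (?br (?be Y) (?al Z)) + ?br (?be (?be Y)) (?br (?be Z) (?al X))
        + ?br (?be (?be Z)) (?br (?be X) (?al Y)) = 0"
      by (simp add: apply_simps A.bihom_jacobi rho_br_first action_additive iota_alpha kappa_psi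
          zero_prod_def)
    show "?br (?al (?be X)) (?mu Y Z) = ?mu (?br (?be X) Y) (?be Z) + ?mu (?be Y) (?br (?al X) Z)"
      by (simp add: apply_simps A.bihom_leibniz rho_lam[of a b w] rho_lam_middle rho_mu_first
          action_additive algebra_simps)
  qed
qed

end

theorem theorem5p16:
  fixes sA :: "'k::{alg_closed_field,field_char_0} \<Rightarrow> 'a::ab_group_add \<Rightarrow> 'a"
    and sV :: "'k \<Rightarrow> 'v::ab_group_add \<Rightarrow> 'v"
    and br \<mu> :: "'a \<Rightarrow> 'a \<Rightarrow> 'a"
    and \<alpha> \<beta> :: "'a \<Rightarrow> 'a"
    and \<phi> \<psi> :: "'v \<Rightarrow> 'v"
    and lam \<rho> :: "'a \<Rightarrow> 'v \<Rightarrow> 'v"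
  assumes "bihom_poisson_algebra sA br \<mu> \<alpha> \<beta>"
    and "left_bihom_poisson_module sA br \<mu> \<alpha> \<beta> sV \<phi> \<psi> lam \<rho>"
    and "bij \<alpha>"
    and "bij \<psi>"
  shows "bihom_poisson_algebra (module_prod.scale sA sV)
    (semidirect_bracket br \<alpha> \<beta> \<phi> \<psi> \<rho>)
    (semidirect_mult \<mu> \<alpha> \<beta> \<phi> \<psi> lam)
    (map_prod \<alpha> \<phi>) (map_prod \<beta> \<psi>)"
proof -
  interpret left_bihom_poisson_module sA br \<mu> \<alpha> \<beta> sV \<phi> \<psi> lam \<rho>
    by (fact assms(2))
  interpret invertible_left_bihom_poisson_module sA br \<mu> \<alpha> \<beta> sV \<phi> \<psi> lam \<rho>
    using assms(3,4) by unfold_locales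
  show ?thesis
    by (fact bihom_poisson_algebra_semidirect)
qed

end
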